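(* Let $k\ge2$ be an integer, let $Q_k=\{-1,1\}^k$ with weight $\mu(\chi)=2^{-k}$ for $\chi\in Q_k$, and let $\mathcal{B}_{k-1}^k=\mathrm{Lin}\{w_S:S\subset\{1,\ldots,k\},\ |S|\le k-1\}$, where $w_S(x)=\prod_{i\in S}x_i$ for $x=(x_1,\ldots,x_k)\in Q_k$. Let $\mathcal{E}$ and $\mathcal{O}$ be the sets of all points of $Q_k$ that have an even and odd number of positive coordinates, respectively. Let $n\ge1$ and let $x^{(1)},\ldots,x^{(n)}\in Q_k$. Then the maximum likelihood estimator (MLE) for $e(\mathcal{B}_{k-1}^k)$ and $x^{(1)},\ldots,x^{(n)}$ exists if and only if $\mathcal{E}\subset\{x^{(1)},\ldots,x^{(n)}\}$ or $\mathcal{O}\subset\{x^{(1)},\ldots,x^{(n)}\}$.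
   Context: For a finite set $\mathcal{X}$ with weight $\mu:\mathcal{X}\to(0,\infty)$ and $\phi\in\mathbb{R}^{\mathcal{X}}$ let $Z(\phi)=\sum_{x\in\mathcal{X}}e^{\phi(x)}\mu(x)$ and $e(\phi)=e^{\phi}/Z(\phi)$. For a linear subspace $\mathcal{B}\subset\mathbb{R}^{\mathcal{X}}$ let $e(\mathcal{B})=\{e(\phi):\phi\in\mathcal{B}\}$. An element $\hat p\in e(\mathcal{B})$ is the MLE for $e(\mathcal{B})$ and a sample $y_1,\ldots,y_n\in\mathcal{X}$ if $\prod_{i=1}^n\hat p(y_i)=\sup_{p\in e(\mathcal{B})}\prod_{i=1}^n p(y_i)$. *)

theory Defs
  imports "HOL-Analysis.Analysis" "HOL-Library.Function_Algebras"
begin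

text \<open>A finite set \<open>X\<close> is a carrier set in some type \<open>'a\<close>, and the elements of $\mathbb{R}^X$ are
  the functions \<open>'a \<Rightarrow> real\<close> that vanish outside \<open>X\<close>; they form a subspace of the space of all
  functions \<open>'a \<Rightarrow> real\<close> with the pointwise operations.\<close>

global_interpretation real_fun: vector_space "\<lambda>(c::real) (f::'a \<Rightarrow> real) x. c * f x"
  by unfold_locales (auto simp: fun_eq_iff algebra_simps)

definition partition_sum :: "'a set \<Rightarrow> ('a \<Rightarrow> real) \<Rightarrow> ('a \<Rightarrow> real) \<Rightarrow> real" where
  "partition_sum X \<mu> \<phi> = (\<Sum>x\<in>X. exp (\<phi> x) * \<mu> x)"

definition exp_density :: "'a set \<Rightarrow> ('a \<Rightarrow> real) \<Rightarrow> ('a \<Rightarrow> real) \<Rightarrow> 'a \<Rightarrow> real" where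
  "exp_density X \<mu> \<phi> x = (if x \<in> X then exp (\<phi> x) / partition_sum X \<mu> \<phi> else 0)"

definition exp_family :: "'a set \<Rightarrow> ('a \<Rightarrow> real) \<Rightarrow> ('a \<Rightarrow> real) set \<Rightarrow> ('a \<Rightarrow> real) set" where
  "exp_family X \<mu> B = exp_density X \<mu> ` B"

definition likelihood :: "nat \<Rightarrow> (nat \<Rightarrow> 'a) \<Rightarrow> ('a \<Rightarrow> real) \<Rightarrow> real" where
  "likelihood n y p = (\<Prod>i\<in>{1..n}. p (y i))"

text \<open>On the exponential family of a nonempty \<open>B\<close> over a finite \<open>X\<close> with positive weight \<open>\<mu>\<close>, every
  density satisfies \<open>0 \<le> p x \<le> 1 / \<mu> x\<close>, so for a sample in \<open>X\<close> the supremum below is that of a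
  nonempty bounded set of reals.\<close>

definition is_MLE ::
  "'a set \<Rightarrow> ('a \<Rightarrow> real) \<Rightarrow> ('a \<Rightarrow> real) set \<Rightarrow> nat \<Rightarrow> (nat \<Rightarrow> 'a) \<Rightarrow> ('a \<Rightarrow> real) \<Rightarrow> bool" where
  "is_MLE X \<mu> B n y p \<longleftrightarrow>
     p \<in> exp_family X \<mu> B \<and> likelihood n y p = (SUP q\<in>exp_family X \<mu> B. likelihood n y q)"

text \<open>The points of $\{-1,1\}^k$ are the functions on \<open>{1..k}\<close> with values $\pm 1$, made
  \<open>undefined\<close> elsewhere by \<open>\<rightarrow>\<^sub>E\<close>, so that two points are equal iff their \<open>k\<close> coordinates are.\<close>

definition cube :: "nat \<Rightarrow> (nat \<Rightarrow> real) set" where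
  "cube k = ({1..k} \<rightarrow>\<^sub>E {-1, 1})"

definition cube_weight :: "nat \<Rightarrow> (nat \<Rightarrow> real) \<Rightarrow> real" where
  "cube_weight k x = 1 / 2 ^ k"

definition walsh :: "nat \<Rightarrow> nat set \<Rightarrow> (nat \<Rightarrow> real) \<Rightarrow> real" where
  "walsh k S x = (if x \<in> cube k then (\<Prod>i\<in>S. x i) else 0)"

definition walsh_space :: "nat \<Rightarrow> nat \<Rightarrow> ((nat \<Rightarrow> real) \<Rightarrow> real) set" where
  "walsh_space k m = real_fun.span {walsh k S |S. S \<subseteq> {1..k} \<and> card S \<le> m}"

definition even_points :: "nat \<Rightarrow> (nat \<Rightarrow> real) set" where
  "even_points k = {x \<in> cube k. even (card {i \<in> {1..k}. x i > 0})}"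

definition odd_points :: "nat \<Rightarrow> (nat \<Rightarrow> real) set" where
  "odd_points k = {x \<in> cube k. odd (card {i \<in> {1..k}. x i > 0})}"

end

theory Submission
  imports Defs
begin

text \<open>Write \<open>E\<close> and \<open>D\<close> for the even and the odd points.  Up to the sign $(-1)^k$, the top Walsh
  function is \<open>1\<close> on \<open>E\<close> and \<open>-1\<close> on \<open>D\<close>, and by the Walsh expansion the span of all the other Walsh
  functions is its orthogonal complement.  So the space in the theorem consists of the functions
  with equal sums over \<open>E\<close> and \<open>D\<close> (\<open>walsh_space_eq_balanced\<close>), and the
  problem reduces to one about two disjoint finite sets of the same size.

  Exponentiating turns equal sums into equal products: the exponential family is the set of
  strictly positive densities \<open>p\<close> with $\prod_E p = \prod_D p$ (\<open>exp_family_balanced_iff\<close>).  Allowing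
  zeros gives a compact set of densities, on which the likelihood attains its maximum
  (\<open>likelihood_attains_max_on_balanced_densities\<close>).  The maximizer has positive likelihood, so it
  is positive at all sample points.  If these include all of \<open>E\<close>, then $\prod_D p = \prod_E p > 0$ forces it to be
  positive on \<open>D\<close> too; it thus lies in the family and is the MLE.

  Conversely, if some \<open>a \<in> E\<close> and \<open>b \<in> D\<close> are both missing from the sample, lowering \<open>\<phi>\<close> by \<open>1\<close> at
  \<open>a\<close> and at \<open>b\<close> keeps the sums over \<open>E\<close> and \<open>D\<close> equal and the values at the sample points unchanged,
  but decreases the partition sum.  Every likelihood in the family can thus be strictly improved.\<close>

section \<open>Exponential families of balanced functions\<close>

definition balanced :: "'a set \<Rightarrow> 'a set \<Rightarrow> ('a \<Rightarrow> real) set" where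
  "balanced E D = {\<phi>. (\<forall>x. x \<notin> E \<union> D \<longrightarrow> \<phi> x = 0) \<and> sum \<phi> E = sum \<phi> D}"

lemma partition_sum_pos:
  assumes "finite X" "X \<noteq> {}" "\<And>x. x \<in> X \<Longrightarrow> \<mu> x > 0"
  shows "partition_sum X \<mu> \<phi> > 0"
  unfolding partition_sum_def using assms by (intro sum_pos) auto

lemma likelihood_exp_density:
  assumes "\<And>i. i \<in> {1..n} \<Longrightarrow> y i \<in> X"
  shows "likelihood n y (exp_density X \<mu> \<phi>) = exp (\<Sum>i\<in>{1..n}. \<phi> (y i)) / partition_sum X \<mu> \<phi> ^ n"
proof -
  have "likelihood n y (exp_density X \<mu> \<phi>) = (\<Prod>i\<in>{1..n}. exp (\<phi> (y i)) / partition_sum X \<mu> \<phi>)"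
    unfolding likelihood_def exp_density_def using assms by (intro prod.cong) auto
  also have "\<dots> = exp (\<Sum>i\<in>{1..n}. \<phi> (y i)) / partition_sum X \<mu> \<phi> ^ n"
    by (simp add: prod_dividef exp_sum)
  finally show ?thesis .
qed

lemma density_bound:
  fixes p \<mu> :: "'a \<Rightarrow> real"
  assumes "finite X" and \<mu>: "\<And>x. x \<in> X \<Longrightarrow> \<mu> x > 0" and p: "\<And>x. x \<in> X \<Longrightarrow> p x \<ge> 0"
    and sum: "(\<Sum>x\<in>X. p x * \<mu> x) = 1" and "x \<in> X"
  shows "p x \<le> 1 / \<mu> x"
proof -
  have "p x * \<mu> x \<le> (\<Sum>x\<in>X. p x * \<mu> x)"
    using assms by (intro member_le_sum) (auto intro: mult_nonneg_nonneg less_imp_le)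
  then show ?thesis using \<mu>[OF \<open>x \<in> X\<close>] sum by (simp add: field_simps)
qed

definition balanced_densities :: "('a \<Rightarrow> real) \<Rightarrow> 'a set \<Rightarrow> 'a set \<Rightarrow> ('a \<Rightarrow> real) set" where
  "balanced_densities \<mu> E D = {p. (\<forall>x. p x \<ge> 0) \<and> (\<forall>x. x \<notin> E \<union> D \<longrightarrow> p x = 0) \<and>
     (\<Sum>x\<in>E \<union> D. p x * \<mu> x) = 1 \<and> prod p E = prod p D}"

context
  fixes E D :: "'a set" and \<mu> :: "'a \<Rightarrow> real"
  assumes fin: "finite E" "finite D" and ne: "E \<union> D \<noteq> {}" and card: "card E = card D"
    and \<mu>: "\<And>x. x \<in> E \<union> D \<Longrightarrow> \<mu> x > 0"
begin

text \<open>The sizes must agree because normalizing subtracts $\ln Z$ from \<open>\<phi>\<close> at every point.\<close>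

lemma exp_family_balanced_iff:
  "p \<in> exp_family (E \<union> D) \<mu> (balanced E D) \<longleftrightarrow>
    (\<forall>x\<in>E \<union> D. p x > 0) \<and> (\<forall>x. x \<notin> E \<union> D \<longrightarrow> p x = 0) \<and>
    (\<Sum>x\<in>E \<union> D. p x * \<mu> x) = 1 \<and> prod p E = prod p D"
    (is "_ \<longleftrightarrow> ?R")
proof
  assume "p \<in> exp_family (E \<union> D) \<mu> (balanced E D)"
  then obtain \<phi> where \<phi>: "\<phi> \<in> balanced E D" and p: "p = exp_density (E \<union> D) \<mu> \<phi>"
    unfolding exp_family_def by blast
  define Z where "Z = partition_sum (E \<union> D) \<mu> \<phi>"
  have Z: "Z > 0" unfolding Z_def using fin ne \<mu> by (intro partition_sum_pos) auto
  have px: "p x = exp (\<phi> x) / Z" if "x \<in> E \<union> D" for x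
    using that by (simp add: p exp_density_def Z_def)
  have "(\<Sum>x\<in>E \<union> D. p x * \<mu> x) = (\<Sum>x\<in>E \<union> D. exp (\<phi> x) * \<mu> x) / Z"
    by (simp add: px sum_divide_distrib del: Un_iff)
  also have "\<dots> = 1"
    using Z by (simp add: Z_def partition_sum_def)
  finally have "(\<Sum>x\<in>E \<union> D. p x * \<mu> x) = 1" .
  moreover have "prod p A = exp (sum \<phi> A) / Z ^ card A" if "finite A" "A \<subseteq> E \<union> D" for A
  proof -
    have "prod p A = (\<Prod>x\<in>A. exp (\<phi> x) / Z)"
      using that px by (intro prod.cong) auto
    then show ?thesis by (simp add: prod_dividef exp_sum that)
  qed
  then have "prod p E = prod p D"
    using \<phi> card fin by (simp add: balanced_def)
  moreover have "\<forall>x\<in>E \<union> D. p x > 0" using Z px by simp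
  moreover have "\<forall>x. x \<notin> E \<union> D \<longrightarrow> p x = 0" by (simp add: p exp_density_def)
  ultimately show ?R by blast
next
  assume R: ?R
  define \<phi> where "\<phi> x = (if x \<in> E \<union> D then ln (p x) else 0)" for x
  have exp_sum_\<phi>: "exp (sum \<phi> A) = prod p A" if "finite A" "A \<subseteq> E \<union> D" for A
  proof -
    have "exp (sum \<phi> A) = (\<Prod>x\<in>A. exp (\<phi> x))" using that by (simp add: exp_sum)
    also have "\<dots> = prod p A" using that R by (intro prod.cong) (auto simp: \<phi>_def)
    finally show ?thesis .
  qed
  have "exp (sum \<phi> E) = exp (sum \<phi> D)" using R fin by (simp add: exp_sum_\<phi>)
  then have bal: "\<phi> \<in> balanced E D" by (auto simp: balanced_def \<phi>_def)
  have "partition_sum (E \<union> D) \<mu> \<phi> = (\<Sum>x\<in>E \<union> D. p x * \<mu> x)"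
    unfolding partition_sum_def using R by (intro sum.cong) (auto simp: \<phi>_def)
  then have "p = exp_density (E \<union> D) \<mu> \<phi>"
    using R by (auto simp: fun_eq_iff exp_density_def \<phi>_def)
  then show "p \<in> exp_family (E \<union> D) \<mu> (balanced E D)"
    using bal by (auto simp: exp_family_def)
qed

lemma exp_family_subset_balanced_densities:
  "exp_family (E \<union> D) \<mu> (balanced E D) \<subseteq> balanced_densities \<mu> E D"
proof
  fix p assume "p \<in> exp_family (E \<union> D) \<mu> (balanced E D)"
  then have p: "\<forall>x\<in>E \<union> D. p x > 0" "\<forall>x. x \<notin> E \<union> D \<longrightarrow> p x = 0"
    "(\<Sum>x\<in>E \<union> D. p x * \<mu> x) = 1" "prod p E = prod p D"
    using exp_family_balanced_iff[of p] by simp_all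
  then have "p x \<ge> 0" for x by (metis less_imp_le order_refl)
  then show "p \<in> balanced_densities \<mu> E D" using p by (simp add: balanced_densities_def)
qed

lemma compact_balanced_densities:
  "compact (balanced_densities \<mu> E D)"
proof -
  define K where "K = PiE UNIV (\<lambda>x. if x \<in> E \<union> D then {0..1 / \<mu> x} else {0})"
  have "compactin (product_topology (\<lambda>_. euclidean) UNIV) K"
    unfolding K_def by (subst compactin_PiE) auto
  then have K: "compact K" by (simp add: euclidean_product_topology)
  have cont: "continuous_on UNIV (\<lambda>p::'a \<Rightarrow> real. p x)" for x
    by (rule continuous_on_product_coordinates)
  have "closed ({p. (\<Sum>x\<in>E \<union> D. p x * \<mu> x) = 1} \<inter> {p. prod p E = prod p D})"
    by (intro closed_Int closed_Collect_eq continuous_intros cont)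
  then have "compact (K \<inter> ({p. (\<Sum>x\<in>E \<union> D. p x * \<mu> x) = 1} \<inter> {p. prod p E = prod p D}))"
    by (rule compact_Int_closed[OF K])
  also have "K \<inter> ({p. (\<Sum>x\<in>E \<union> D. p x * \<mu> x) = 1} \<inter> {p. prod p E = prod p D}) =
    balanced_densities \<mu> E D" (is "?L = ?P")
  proof
    show "?L \<subseteq> ?P"
    proof
      fix p assume p: "p \<in> ?L"
      then have "p x \<in> (if x \<in> E \<union> D then {0..1 / \<mu> x} else {0})" for x
        unfolding K_def by (blast dest: PiE_mem)
      then have "p x \<ge> 0" "x \<notin> E \<union> D \<longrightarrow> p x = 0" for x
        by (metis atLeastAtMost_iff order_refl singletonD)+
      then show "p \<in> ?P" using p by (auto simp: balanced_densities_def)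
    qed
    show "?P \<subseteq> ?L"
    proof
      fix p assume p: "p \<in> ?P"
      then have "p x \<le> 1 / \<mu> x" if "x \<in> E \<union> D" for x
        using p that fin \<mu>
        by (intro density_bound[of "E \<union> D"]) (auto simp: balanced_densities_def)
      then show "p \<in> ?L" using p by (auto simp: balanced_densities_def K_def)
    qed
  qed
  finally show ?thesis .
qed

context
  fixes n :: nat and y :: "nat \<Rightarrow> 'a"
  assumes y: "\<And>i. i \<in> {1..n} \<Longrightarrow> y i \<in> E \<union> D"
begin

text \<open>The constant density is balanced and has positive likelihood, so the maximum is positive.\<close>

lemma likelihood_attains_max_on_balanced_densities:
  obtains p where "p \<in> balanced_densities \<mu> E D" "likelihood n y p > 0"
    "\<And>q. q \<in> balanced_densities \<mu> E D \<Longrightarrow> likelihood n y q \<le> likelihood n y p"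
proof -
  define u where "u x = (if x \<in> E \<union> D then 1 / sum \<mu> (E \<union> D) else 0)" for x
  have pos: "sum \<mu> (E \<union> D) > 0" using fin ne \<mu> by (intro sum_pos) auto
  have "(\<Sum>x\<in>E \<union> D. u x * \<mu> x) = sum \<mu> (E \<union> D) / sum \<mu> (E \<union> D)"
    by (simp add: u_def flip: sum_divide_distrib)
  moreover have "prod u E = prod u D" using card by (simp add: u_def)
  ultimately have u: "u \<in> balanced_densities \<mu> E D"
    using pos by (auto simp: balanced_densities_def u_def)
  have "likelihood n y u > 0"
    unfolding likelihood_def using y pos by (intro prod_pos) (auto simp: u_def)
  moreover have "continuous_on (balanced_densities \<mu> E D) (likelihood n y)"
    unfolding likelihood_def
    by (intro continuous_intros continuous_on_subset[OF continuous_on_product_coordinates]) auto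
  then obtain p where p: "p \<in> balanced_densities \<mu> E D"
    "\<And>q. q \<in> balanced_densities \<mu> E D \<Longrightarrow> likelihood n y q \<le> likelihood n y p"
    using continuous_attains_sup[OF compact_balanced_densities] u by blast
  ultimately show thesis
    using that[OF p(1)] u by (meson less_le_trans)
qed

lemma likelihood_bdd_above:
  "bdd_above (likelihood n y ` exp_family (E \<union> D) \<mu> (balanced E D))"
proof -
  obtain p where p: "\<And>q. q \<in> balanced_densities \<mu> E D \<Longrightarrow> likelihood n y q \<le> likelihood n y p"
    using likelihood_attains_max_on_balanced_densities by blast
  show ?thesis
    using p exp_family_subset_balanced_densities by (intro bdd_aboveI2) blast
qed

lemma is_MLE_balanced_iff_max:
  "is_MLE (E \<union> D) \<mu> (balanced E D) n y p \<longleftrightarrow>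
    p \<in> exp_family (E \<union> D) \<mu> (balanced E D) \<and>
    (\<forall>q\<in>exp_family (E \<union> D) \<mu> (balanced E D). likelihood n y q \<le> likelihood n y p)"
    (is "_ \<longleftrightarrow> p \<in> ?F \<and> ?max")
proof -
  have "likelihood n y p = (SUP q\<in>?F. likelihood n y q) \<longleftrightarrow> ?max" if "p \<in> ?F"
  proof
    assume "likelihood n y p = (SUP q\<in>?F. likelihood n y q)"
    then show ?max using cSUP_upper[OF _ likelihood_bdd_above] by metis
  next
    assume ?max
    then have "Sup (likelihood n y ` ?F) = likelihood n y p"
      using that by (intro cSup_eq_maximum) blast+
    then show "likelihood n y p = (SUP q\<in>?F. likelihood n y q)" by (rule sym)
  qed
  then show ?thesis unfolding is_MLE_def by blast
qed

text \<open>The maximizer over the compact set has no zero at a sample point, hence none on the covered half;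
  equality of the products carries this over to the other half.\<close>

lemma MLE_exists_if_covered:
  assumes covered: "E \<subseteq> y ` {1..n} \<or> D \<subseteq> y ` {1..n}"
  shows "\<exists>p. is_MLE (E \<union> D) \<mu> (balanced E D) n y p"
proof -
  obtain p where p: "p \<in> balanced_densities \<mu> E D" and lpos: "likelihood n y p > 0"
    and max: "\<And>q. q \<in> balanced_densities \<mu> E D \<Longrightarrow> likelihood n y q \<le> likelihood n y p"
    using likelihood_attains_max_on_balanced_densities by blast
  have "p (y i) \<noteq> 0" if "i \<in> {1..n}" for i
    using lpos that unfolding likelihood_def by (metis finite_atLeastAtMost less_irrefl prod_zero)
  then have "prod p E \<noteq> 0 \<or> prod p D \<noteq> 0"
    using covered fin by (auto simp: prod_zero_iff)
  then have "prod p E \<noteq> 0 \<and> prod p D \<noteq> 0"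
    using p by (auto simp: balanced_densities_def)
  then have "\<forall>x\<in>E \<union> D. p x \<noteq> 0"
    using fin by (auto simp: prod_zero_iff)
  then have "p \<in> exp_family (E \<union> D) \<mu> (balanced E D)"
    using p unfolding exp_family_balanced_iff balanced_densities_def
    by (auto simp: less_le)
  then show ?thesis
    using max is_MLE_balanced_iff_max exp_family_subset_balanced_densities by blast
qed

text \<open>Lowering \<open>\<phi>\<close> equally at one unsampled point of each half preserves balance and leaves the
  unnormalized likelihood alone, so only the normalization changes.\<close>

lemma likelihood_improvable_if_uncovered:
  assumes disj: "E \<inter> D = {}" and "n \<ge> 1"
    and a: "a \<in> E" "a \<notin> y ` {1..n}" and b: "b \<in> D" "b \<notin> y ` {1..n}"
    and p: "p \<in> exp_family (E \<union> D) \<mu> (balanced E D)"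
  shows "\<exists>q\<in>exp_family (E \<union> D) \<mu> (balanced E D). likelihood n y p < likelihood n y q"
proof -
  obtain \<phi> where \<phi>: "\<phi> \<in> balanced E D" and p_eq: "p = exp_density (E \<union> D) \<mu> \<phi>"
    using p unfolding exp_family_def by blast
  define \<psi> where "\<psi> x = \<phi> x - (if x = a then 1 else 0) - (if x = b then 1 else 0)" for x
  have "a \<notin> D" "b \<notin> E" using a b disj by auto
  then have bal: "\<psi> \<in> balanced E D"
    using \<phi> a b fin by (auto simp: balanced_def \<psi>_def sum_subtractf)
  have "partition_sum (E \<union> D) \<mu> \<psi> < partition_sum (E \<union> D) \<mu> \<phi>"
    unfolding partition_sum_def
  proof (rule sum_strict_mono_ex1)
    show "\<forall>x\<in>E \<union> D. exp (\<psi> x) * \<mu> x \<le> exp (\<phi> x) * \<mu> x"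
      using \<mu> by (auto simp: \<psi>_def intro!: mult_right_mono less_imp_le)
    show "\<exists>x\<in>E \<union> D. exp (\<psi> x) * \<mu> x < exp (\<phi> x) * \<mu> x"
      using \<mu> a by (intro bexI[of _ a]) (auto simp: \<psi>_def intro!: mult_strict_right_mono)
  qed (use fin in auto)
  moreover have pos: "partition_sum (E \<union> D) \<mu> \<psi> > 0"
    using fin \<mu> a by (intro partition_sum_pos) auto
  ultimately have "partition_sum (E \<union> D) \<mu> \<psi> ^ n < partition_sum (E \<union> D) \<mu> \<phi> ^ n"
    using \<open>n \<ge> 1\<close> by (intro power_strict_mono) auto
  moreover have "\<psi> (y i) = \<phi> (y i)" if "i \<in> {1..n}" for i
    using a b that by (auto simp: \<psi>_def)
  then have "(\<Sum>i\<in>{1..n}. \<psi> (y i)) = (\<Sum>i\<in>{1..n}. \<phi> (y i))" by (intro sum.cong) auto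
  moreover have "0 < partition_sum (E \<union> D) \<mu> \<psi> ^ n" using pos by simp
  ultimately have "likelihood n y p < likelihood n y (exp_density (E \<union> D) \<mu> \<psi>)"
    unfolding p_eq using likelihood_exp_density[of n y "E \<union> D" \<mu>] y
    by (simp add: divide_strict_left_mono del: Un_iff)
  then show ?thesis using bal unfolding exp_family_def by blast
qed

theorem MLE_balanced_exists_iff:
  assumes disj: "E \<inter> D = {}" and n: "n \<ge> 1"
  shows "(\<exists>p. is_MLE (E \<union> D) \<mu> (balanced E D) n y p) \<longleftrightarrow>
    E \<subseteq> y ` {1..n} \<or> D \<subseteq> y ` {1..n}"
proof
  assume "\<exists>p. is_MLE (E \<union> D) \<mu> (balanced E D) n y p"
  then obtain p where "p \<in> exp_family (E \<union> D) \<mu> (balanced E D)"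
    "\<forall>q\<in>exp_family (E \<union> D) \<mu> (balanced E D). likelihood n y q \<le> likelihood n y p"
    using is_MLE_balanced_iff_max by blast
  then show "E \<subseteq> y ` {1..n} \<or> D \<subseteq> y ` {1..n}"
    using likelihood_improvable_if_uncovered[OF disj n] by (meson not_less subsetI)
qed (rule MLE_exists_if_covered)

end

end

section \<open>The Walsh functions of degree less than k\<close>

lemma finite_cube: "finite (cube k)"
  by (auto simp: cube_def intro: finite_PiE)

lemma cube_coord: "x \<in> cube k \<Longrightarrow> i \<in> {1..k} \<Longrightarrow> x i = -1 \<or> x i = 1"
  by (auto simp: cube_def PiE_iff)

text \<open>The summand factors over the coordinates, and a coordinate outside \<open>S\<close> contributes the factor
  \<open>-1 + 1\<close>.\<close>

lemma walsh_orthogonal_top: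
  assumes "S \<subset> {1..k}"
  shows "(\<Sum>x\<in>cube k. walsh k S x * walsh k {1..k} x) = 0"
proof -
  define f where "f i t = (if i \<in> S then t * t else t)" for i and t :: real
  have S: "S \<subseteq> {1..k}" using assms by auto
  have "walsh k S x * walsh k {1..k} x = (\<Prod>i\<in>{1..k}. f i (x i))" if "x \<in> cube k" for x
  proof -
    have "(\<Prod>i\<in>S. x i) = (\<Prod>i\<in>{1..k}. if i \<in> S then x i else 1)"
      using S by (simp add: prod.If_cases Int_absorb1)
    then have "walsh k S x * walsh k {1..k} x =
        (\<Prod>i\<in>{1..k}. (if i \<in> S then x i else 1) * x i)"
      using that by (simp add: walsh_def prod.distrib)
    also have "\<dots> = (\<Prod>i\<in>{1..k}. f i (x i))"
      by (intro prod.cong) (auto simp: f_def)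
    finally show ?thesis .
  qed
  then have "(\<Sum>x\<in>cube k. walsh k S x * walsh k {1..k} x) =
      (\<Sum>x\<in>cube k. \<Prod>i\<in>{1..k}. f i (x i))"
    by (intro sum.cong) auto
  also have "\<dots> = (\<Prod>i\<in>{1..k}. \<Sum>t\<in>{-1, 1}. f i t)"
    unfolding cube_def by (subst prod_sum_PiE) auto
  also have "\<dots> = 0"
    using assms by (intro prod_zero) (auto simp: f_def)
  finally show ?thesis .
qed

text \<open>Multiplying out $\prod_i (a_i x_i + 1)$ gives the sum; if \<open>a\<close> and \<open>x\<close> differ, some factor is
  \<open>0\<close>.\<close>

lemma walsh_completeness:
  assumes a: "a \<in> cube k" and x: "x \<in> cube k"
  shows "(\<Sum>S\<in>Pow {1..k}. walsh k S a * walsh k S x) = (if x = a then 2 ^ k else 0)"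
proof -
  have "(\<Sum>S\<in>Pow {1..k}. walsh k S a * walsh k S x) =
      (\<Sum>S\<in>Pow {1..k}. \<Prod>i\<in>S. a i * x i)"
    using a x by (simp add: walsh_def prod.distrib)
  also have "\<dots> = (\<Prod>i\<in>{1..k}. a i * x i + 1)"
    by (subst prod_add) auto
  also have "\<dots> = (if x = a then 2 ^ k else 0)"
  proof (cases "x = a")
    case True
    have "a i * a i + 1 = 2" if "i \<in> {1..k}" for i using cube_coord[OF a that] by auto
    then show ?thesis using True by simp
  next
    case False
    then obtain i where i: "i \<in> {1..k}" "x i \<noteq> a i"
      using a x unfolding cube_def by (meson PiE_ext)
    then have "a i * x i + 1 = 0" using cube_coord[OF a i(1)] cube_coord[OF x i(1)] by auto
    then show ?thesis using False i by (auto intro!: prod_zero)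
  qed
  finally show ?thesis .
qed

lemma sum_fun_apply: "(\<Sum>i\<in>A. f i) x = (\<Sum>i\<in>A. f i x)" for f :: "'i \<Rightarrow> 'a \<Rightarrow> real"
  by (induction A rule: infinite_finite_induct) auto

lemma walsh_expansion:
  assumes \<phi>: "\<And>x. x \<notin> cube k \<Longrightarrow> \<phi> x = 0"
  shows "\<phi> = (\<Sum>S\<in>Pow {1..k}. (\<lambda>x. (\<Sum>a\<in>cube k. \<phi> a * walsh k S a) / 2 ^ k * walsh k S x))"
proof
  fix x
  show "\<phi> x =
    (\<Sum>S\<in>Pow {1..k}. (\<lambda>x. (\<Sum>a\<in>cube k. \<phi> a * walsh k S a) / 2 ^ k * walsh k S x)) x"
  proof (cases "x \<in> cube k")
    case True
    have "(\<Sum>S\<in>Pow {1..k}. (\<Sum>a\<in>cube k. \<phi> a * walsh k S a) / 2 ^ k * walsh k S x) =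
        (\<Sum>S\<in>Pow {1..k}. \<Sum>a\<in>cube k. \<phi> a / 2 ^ k * (walsh k S a * walsh k S x))"
      by (simp add: sum_distrib_left sum_divide_distrib mult_ac)
    also have "\<dots> = (\<Sum>a\<in>cube k. \<phi> a / 2 ^ k * (\<Sum>S\<in>Pow {1..k}. walsh k S a * walsh k S x))"
      by (subst sum.swap) (simp add: sum_distrib_left)
    also have "\<dots> = (\<Sum>a\<in>cube k. if x = a then \<phi> a else 0)"
      using True by (intro sum.cong) (auto simp: walsh_completeness simp del: One_nat_def)
    also have "\<dots> = \<phi> x" using True finite_cube by simp
    finally show ?thesis by (simp add: sum_fun_apply)
  next
    case False
    then show ?thesis by (simp add: \<phi> walsh_def sum_fun_apply)
  qed
qed

text \<open>A function orthogonal to the top Walsh function has no top term in its expansion.\<close>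

lemma walsh_space_eq_orthogonal_top:
  assumes "k \<ge> 1"
  shows "walsh_space k (k - 1) =
    {\<phi>. (\<forall>x. x \<notin> cube k \<longrightarrow> \<phi> x = 0) \<and> (\<Sum>x\<in>cube k. \<phi> x * walsh k {1..k} x) = 0}"
    (is "_ = ?O")
proof
  have small_iff: "S \<subseteq> {1..k} \<and> card S \<le> k - 1 \<longleftrightarrow> S \<subset> {1..k}" for S
    using assms card_subset_eq[of "{1..k}" S] psubset_card_mono[of "{1..k}" S] by fastforce
  show "walsh_space k (k - 1) \<subseteq> ?O"
    unfolding walsh_space_def
  proof (rule real_fun.span_minimal)
    show "{walsh k S |S. S \<subseteq> {1..k} \<and> card S \<le> k - 1} \<subseteq> ?O"
    proof
      fix \<phi> assume "\<phi> \<in> {walsh k S |S. S \<subseteq> {1..k} \<and> card S \<le> k - 1}"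
      then obtain S where "S \<subset> {1..k}" "\<phi> = walsh k S" unfolding small_iff by blast
      then show "\<phi> \<in> ?O"
        using walsh_orthogonal_top[of S k] by (simp add: walsh_def[of k S])
    qed
    show "real_fun.subspace ?O"
      by (rule real_fun.subspaceI)
        (auto simp: distrib_right sum.distrib mult.assoc simp flip: sum_distrib_left)
  qed
  show "?O \<subseteq> walsh_space k (k - 1)"
  proof
    fix \<phi> assume \<phi>: "\<phi> \<in> ?O"
    have "(\<Sum>S\<in>Pow {1..k}. (\<lambda>x. (\<Sum>a\<in>cube k. \<phi> a * walsh k S a) / 2 ^ k * walsh k S x))
        \<in> walsh_space k (k - 1)"
      unfolding walsh_space_def
    proof (rule real_fun.span_sum)
      fix S assume S: "S \<in> Pow {1..k}"
      let ?B = "{walsh k S |S. S \<subseteq> {1..k} \<and> card S \<le> k - 1}"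
      show "(\<lambda>x. (\<Sum>a\<in>cube k. \<phi> a * walsh k S a) / 2 ^ k * walsh k S x) \<in> real_fun.span ?B"
      proof (cases "S = {1..k}")
        case True
        then have "(\<lambda>x. (\<Sum>a\<in>cube k. \<phi> a * walsh k S a) / 2 ^ k * walsh k S x) = 0"
          using \<phi> by (auto simp: fun_eq_iff)
        then show ?thesis using real_fun.span_zero by metis
      next
        case False
        then have "walsh k S \<in> ?B" using S unfolding small_iff by blast
        then show ?thesis by (intro real_fun.span_scale real_fun.span_base)
      qed
    qed
    then show "\<phi> \<in> walsh_space k (k - 1)" using walsh_expansion[of k \<phi>] \<phi> by simp
  qed
qed

section \<open>Even and odd points\<close>

lemma even_Un_odd_points: "even_points k \<union> odd_points k = cube k"
  by (auto simp: even_points_def odd_points_def)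

lemma even_Int_odd_points: "even_points k \<inter> odd_points k = {}"
  by (auto simp: even_points_def odd_points_def)

text \<open>The sign $(-1)^k$ comes in because parity counts the positive coordinates, whereas the product
  of the coordinates has the parity of the negative ones.\<close>

lemma walsh_top:
  assumes "x \<in> cube k"
  shows "walsh k {1..k} x = (-1) ^ k * (if x \<in> even_points k then 1 else -1)"
proof -
  have "(-1) ^ k * walsh k {1..k} x = (\<Prod>i\<in>{1..k}. - x i)"
    using assms by (simp add: walsh_def prod_uminus)
  also have "\<dots> = (\<Prod>i\<in>{1..k}. if x i > 0 then -1 else 1)"
    using cube_coord[OF assms] by (intro prod.cong) fastforce+
  also have "\<dots> = (-1) ^ card {i \<in> {1..k}. x i > 0}"
    by (simp add: prod.If_cases Int_def)
  finally have "(-1) ^ k * walsh k {1..k} x = (if x \<in> even_points k then 1 else -1)"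
    using assms by (simp add: even_points_def)
  then have "(-1) ^ k * ((-1) ^ k * walsh k {1..k} x) =
      (-1) ^ k * (if x \<in> even_points k then 1 else -1)"
    by (rule arg_cong)
  then show ?thesis by (simp flip: mult.assoc power_add)
qed

lemma sum_walsh_top:
  "(\<Sum>x\<in>cube k. \<phi> x * walsh k {1..k} x) =
    (-1) ^ k * (sum \<phi> (even_points k) - sum \<phi> (odd_points k))"
proof -
  have fin: "finite (even_points k)" "finite (odd_points k)"
    using finite_cube[of k] by (auto simp: even_points_def odd_points_def)
  let ?f = "\<lambda>x. \<phi> x * walsh k {1..k} x"
  have "sum ?f (cube k) = sum ?f (even_points k) + sum ?f (odd_points k)"
    using sum.union_disjoint[OF fin even_Int_odd_points] by (simp add: even_Un_odd_points)
  also have "sum ?f (even_points k) = (\<Sum>x\<in>even_points k. (-1) ^ k * \<phi> x)"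
  proof (rule sum.cong)
    fix x assume x: "x \<in> even_points k"
    then show "?f x = (-1) ^ k * \<phi> x" using walsh_top[of x k] even_Un_odd_points[of k] by auto
  qed simp
  also have "sum ?f (odd_points k) = (\<Sum>x\<in>odd_points k. - ((-1) ^ k * \<phi> x))"
  proof (rule sum.cong)
    fix x assume x: "x \<in> odd_points k"
    then have "x \<notin> even_points k" using even_Int_odd_points[of k] by auto
    then show "?f x = - ((-1) ^ k * \<phi> x)"
      using x walsh_top[of x k] even_Un_odd_points[of k] by auto
  qed simp
  finally show ?thesis
    by (simp add: sum_negf right_diff_distrib flip: sum_distrib_left)
qed

lemma walsh_space_eq_balanced:
  assumes "k \<ge> 1"
  shows "walsh_space k (k - 1) = balanced (even_points k) (odd_points k)"
  unfolding walsh_space_eq_orthogonal_top[OF assms] balanced_def sum_walsh_top even_Un_odd_points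
  by simp

text \<open>The equality of the sizes is the orthogonality of the constant to the top Walsh function.\<close>

lemma card_even_points_eq_odd_points:
  assumes "k \<ge> 1"
  shows "card (even_points k) = card (odd_points k)"
proof -
  have "(\<Sum>x\<in>cube k. 1 * walsh k {1..k} x) = (\<Sum>x\<in>cube k. walsh k {} x * walsh k {1..k} x)"
    by (intro sum.cong) (auto simp: walsh_def)
  also have "\<dots> = 0" using assms by (intro walsh_orthogonal_top) auto
  finally show ?thesis using sum_walsh_top[of "\<lambda>_. 1" k] by simp
qed

theorem theorem5p3:
  fixes k n :: nat and x :: "nat \<Rightarrow> nat \<Rightarrow> real"
  assumes "k \<ge> 2" and "n \<ge> 1"
    and "\<And>i. i \<in> {1..n} \<Longrightarrow> x i \<in> cube k"
  shows "(\<exists>p. is_MLE (cube k) (cube_weight k) (walsh_space k (k - 1)) n x p) \<longleftrightarrow>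
    even_points k \<subseteq> x ` {1..n} \<or> odd_points k \<subseteq> x ` {1..n}"
proof -
  have k: "k \<ge> 1" using assms(1) by simp
  have fin: "finite (even_points k)" "finite (odd_points k)"
    using finite_cube[of k] by (auto simp: even_points_def odd_points_def)
  have "cube k \<noteq> {}" using assms(2) assms(3)[of 1] by auto
  then show ?thesis
    unfolding walsh_space_eq_balanced[OF k] even_Un_odd_points[of k, symmetric]
    using assms(2,3) fin card_even_points_eq_odd_points[OF k]
    by (intro MLE_balanced_exists_iff even_Int_odd_points)
      (auto simp: cube_weight_def even_Un_odd_points)
qed

end
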